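(* Let $n\geq 1$, let $A$ be a set, and let $\Phi$ be a set of partial $n$-place functions on $A$ that contains the empty function $\varnothing$ and is closed under the Menger superposition $\mathrm{O}$ and under the set-theoretic difference $\setminus$ (i.e. $(\Phi,\mathrm{O},\setminus,\varnothing)$ is a difference Menger algebra of $n$-place functions). Then $(\Phi,\mathrm{O},\setminus,\varnothing)$ is a subtraction Menger algebra of rank $n$.
   Context: Partial $n$-place functions: a partial $n$-place function on a set $A$ is a partial mapping from $A^n$ into $A$, regarded as a subset of $A^{n+1}$; the set of all of them is $\mathcal{F}(A^n,A)$. The Menger superposition $\mathrm{O}:(f,g_1,\ldots,g_n)\mapsto f[g_1\ldots g_n]$ on $\mathcal{F}(A^n,A)$ is defined by: $(\bar a,c)\in f[g_1\ldots g_n]$ if and only if there is $\bar b=(b_1,\ldots,b_n)\in A^n$ with $(\bar a,b_1)\in g_1,\ldots,(\bar a,b_n)\in g_n$ and $(\bar b,c)\in f$ (for $\bar a\in A^n$, $c\in A$). A difference Menger algebra of $n$-place functions is an algebra $(\Phi,\mathrm{O},\setminus,\varnothing)$ where $\Phi\subseteq\mathcal{F}(A^n,A)$, $\varnothing\in\Phi$, $\Phi$ is closed under $\mathrm{O}$ and under the set-theoretic difference $\setminus$ of functions viewed as subsets of $A^{n+1}$. A Menger algebra of rank $n$ is a non-empty set $G$ with an $(n+1)$-ary operation $o(x,y_1,\ldots,y_n)=x[y_1\ldots y_n]$ satisfying $x[y_1\ldots y_n][z_1\ldots z_n]=x[y_1[z_1\ldots z_n]\ldots y_n[z_1\ldots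 z_n]]$. For $\bar w=(w_1,\ldots,w_n)\in G^n$ write $u[\bar w|_i\,x]=u[w_1\ldots w_{i-1}\,x\,w_{i+1}\ldots w_n]$. The set $T_n(G)$ of polynomials is the smallest set of words in a variable $x\notin G$ such that $x\in T_n(G)$, and $a[b_1\ldots b_{i-1}\,t\,b_{i+1}\ldots b_n]\in T_n(G)$ whenever $i\in\{1,\ldots,n\}$, $a,b_j\in G$ ($j\ne i$) and $t\in T_n(G)$; for $g\in G$, $t(g)\in G$ is the value of $t$ when $x$ is replaced by $g$. A subtraction algebra is an algebra $(G,-,0)$ of type $(2,0)$ satisfying $x-(y-x)=x$, $x-(x-y)=y-(y-x)$, $(x-y)-z=(x-z)-y$, $0-0=0$. A subtraction Menger algebra of rank $n$ is an algebra $(G,o,-,0)$ of type $(n+1,2,0)$ such that $(G,o)$ is a Menger algebra of rank $n$, $(G,-,0)$ is a subtraction algebra, and for all $x,y,z,u,z_1,\ldots,z_n\in G$, $\bar w\in G^n$, $i=1,\ldots,n$, $t_1,t_2\in T_n(G)$: (i) $(x-y)[z_1\ldots z_n]=x[z_1\ldots z_n]-y[z_1\ldots z_n]$; (ii) $u[\bar w|_i\,(x-(x-y))]=u[\bar w|_i\,x]-u[\bar w|_i\,(x-y)]$; (iii) if $x-y=0$, $z-t_1(x)=0$ and $z-t_2(y)=0$, then $z-t_2(x)=0$. *)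

theory Defs
  imports Main
begin

text \<open>Tuples in \<open>S\<close> to the power \<open>n\<close> are lists of length \<open>n\<close>, so positions run from \<open>0\<close> to
  \<open>n - 1\<close>, and \<open>ws[i := x]\<close> is the tuple \<open>ws\<close> with its entry at position \<open>i\<close> replaced by \<open>x\<close>.\<close>

definition tuples :: "nat \<Rightarrow> 'a set \<Rightarrow> 'a list set" where
  "tuples n S = {xs. length xs = n \<and> set xs \<subseteq> S}"

text \<open>A partial \<open>n\<close>-place function is its graph; an \<open>(n + 1)\<close>-tuple of the graph is kept as
  a pair of an argument tuple and a value.\<close>

type_synonym 'a pfun = "('a list \<times> 'a) set"

definition partial_functions :: "nat \<Rightarrow> 'a set \<Rightarrow> 'a pfun set" where
  "partial_functions n A = {f. f \<subseteq> tuples n A \<times> A \<and> single_valued f}"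

definition superposition :: "nat \<Rightarrow> 'a set \<Rightarrow> 'a pfun \<Rightarrow> 'a pfun list \<Rightarrow> 'a pfun" where
  "superposition n A f gs =
     {(as, c). as \<in> tuples n A \<and> c \<in> A \<and>
        (\<exists>bs \<in> tuples n A. (\<forall>i<n. (as, bs ! i) \<in> gs ! i) \<and> (bs, c) \<in> f)}"

locale difference_menger_algebra =
  fixes n :: nat and A :: "'a set" and \<Phi> :: "'a pfun set"
  assumes partial_functions: "\<Phi> \<subseteq> partial_functions n A"
    and empty_mem: "{} \<in> \<Phi>"
    and superposition_closed:
      "\<lbrakk>f \<in> \<Phi>; gs \<in> tuples n \<Phi>\<rbrakk> \<Longrightarrow> superposition n A f gs \<in> \<Phi>"
    and difference_closed: "\<lbrakk>f \<in> \<Phi>; g \<in> \<Phi>\<rbrakk> \<Longrightarrow> f - g \<in> \<Phi>"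

locale menger_algebra =
  fixes n :: nat and G :: "'g set" and opr :: "'g \<Rightarrow> 'g list \<Rightarrow> 'g"
  assumes nonempty: "G \<noteq> {}"
    and opr_closed: "\<lbrakk>x \<in> G; ys \<in> tuples n G\<rbrakk> \<Longrightarrow> opr x ys \<in> G"
    and superassociative:
      "\<lbrakk>x \<in> G; ys \<in> tuples n G; zs \<in> tuples n G\<rbrakk>
        \<Longrightarrow> opr (opr x ys) zs = opr x (map (\<lambda>y. opr y zs) ys)"

text \<open>The word \<open>App a bs t cs\<close> stands for \<open>a\<close> applied to the tuple \<open>bs\<close>, then \<open>t\<close>, then \<open>cs\<close>;
  the position of \<open>t\<close> in this tuple is \<open>length bs\<close>. Every word has exactly one variable.\<close>

datatype 'g word = Var | App 'g "'g list" "'g word" "'g list"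

inductive_set polynomials :: "nat \<Rightarrow> 'g set \<Rightarrow> 'g word set" for n :: nat and G :: "'g set" where
  var: "Var \<in> polynomials n G"
| app: "\<lbrakk>a \<in> G; set bs \<subseteq> G; set cs \<subseteq> G; length bs + 1 + length cs = n; t \<in> polynomials n G\<rbrakk>
        \<Longrightarrow> App a bs t cs \<in> polynomials n G"

primrec word_value :: "('g \<Rightarrow> 'g list \<Rightarrow> 'g) \<Rightarrow> 'g word \<Rightarrow> 'g \<Rightarrow> 'g" where
  "word_value opr Var g = g"
| "word_value opr (App a bs t cs) g = opr a (bs @ [word_value opr t g] @ cs)"

locale subtraction_algebra =
  fixes G :: "'g set" and sub :: "'g \<Rightarrow> 'g \<Rightarrow> 'g" (infixl \<open>\<ominus>\<close> 65) and zero :: 'g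
  assumes sub_closed: "\<lbrakk>x \<in> G; y \<in> G\<rbrakk> \<Longrightarrow> x \<ominus> y \<in> G"
    and zero_closed: "zero \<in> G"
    and sub_sub_self: "\<lbrakk>x \<in> G; y \<in> G\<rbrakk> \<Longrightarrow> x \<ominus> (y \<ominus> x) = x"
    and sub_sub_commute: "\<lbrakk>x \<in> G; y \<in> G\<rbrakk> \<Longrightarrow> x \<ominus> (x \<ominus> y) = y \<ominus> (y \<ominus> x)"
    and sub_right_commute:
      "\<lbrakk>x \<in> G; y \<in> G; z \<in> G\<rbrakk> \<Longrightarrow> (x \<ominus> y) \<ominus> z = (x \<ominus> z) \<ominus> y"
    and zero_sub_zero: "zero \<ominus> zero = zero"

locale subtraction_menger_algebra =
  menger_algebra n G opr + subtraction_algebra G sub zero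
  for n :: nat and G :: "'g set" and opr :: "'g \<Rightarrow> 'g list \<Rightarrow> 'g"
    and sub :: "'g \<Rightarrow> 'g \<Rightarrow> 'g" (infixl \<open>\<ominus>\<close> 65) and zero :: 'g +
  assumes opr_sub:
      "\<lbrakk>x \<in> G; y \<in> G; zs \<in> tuples n G\<rbrakk>
        \<Longrightarrow> opr (x \<ominus> y) zs = opr x zs \<ominus> opr y zs"
    and opr_update_sub:
      "\<lbrakk>u \<in> G; x \<in> G; y \<in> G; ws \<in> tuples n G; i < n\<rbrakk>
        \<Longrightarrow> opr u (ws[i := x \<ominus> (x \<ominus> y)])
          = opr u (ws[i := x]) \<ominus> opr u (ws[i := x \<ominus> y])"
    and polynomial_sub:
      "\<lbrakk>x \<in> G; y \<in> G; z \<in> G; t1 \<in> polynomials n G; t2 \<in> polynomials n G;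
        x \<ominus> y = zero; z \<ominus> word_value opr t1 x = zero; z \<ominus> word_value opr t2 y = zero\<rbrakk>
        \<Longrightarrow> z \<ominus> word_value opr t2 x = zero"

end

theory Submission
  imports Defs
begin

text \<open>Two observations carry the proof. First, the functions are single-valued, so \<open>g\<^sub>1, \<dots>, g\<^sub>n\<close>
  send an argument tuple \<open>as\<close> to at most one intermediate tuple \<open>bs\<close>, and
  \<open>f[g\<^sub>1 \<dots> g\<^sub>n]\<close> at \<open>as\<close> is \<open>f\<close> at this \<open>bs\<close>. The existential quantifier over \<open>bs\<close> in the
  superposition thus commutes with conjunction and with set difference, which gives
  superassociativity and the two distributive laws for \<open>-\<close>; here \<open>x - (x - y)\<close> is the
  intersection \<open>x \<inter> y\<close>.

  Secondly, the value of a polynomial at \<open>as\<close> depends on its variable only through the value of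
  the variable at \<open>as\<close>, and it is defined at \<open>as\<close> only where the variable is. Since
  \<open>z - t = {}\<close> means \<open>z \<subseteq> t\<close>, the last axiom says that \<open>x \<subseteq> y\<close>, \<open>z \<subseteq> t\<^sub>1(x)\<close> and
  \<open>z \<subseteq> t\<^sub>2(y)\<close> imply \<open>z \<subseteq> t\<^sub>2(x)\<close>: the inclusion \<open>z \<subseteq> t\<^sub>1(x)\<close> makes \<open>x\<close>
  defined at each point of the domain of \<open>z\<close>, there \<open>x\<close> and its extension \<open>y\<close> agree, and
  hence so do \<open>t\<^sub>2(x)\<close> and \<open>t\<^sub>2(y)\<close>.\<close>

definition joint_value :: "'a pfun list \<Rightarrow> 'a list \<Rightarrow> 'a list \<Rightarrow> bool" where
  "joint_value gs as bs \<longleftrightarrow> list_all2 (\<lambda>g b. (as, b) \<in> g) gs bs"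

text \<open>The bounds on \<open>as\<close>, \<open>bs\<close> and \<open>c\<close> in the superposition follow from those on the functions
  involved. For \<open>as\<close> this takes at least one inner function, hence \<open>n \<ge> 1\<close>.\<close>

lemma mem_superposition_iff:
  assumes "n \<ge> 1" "f \<in> partial_functions n A" "gs \<in> tuples n (partial_functions n A)"
  shows "(as, c) \<in> superposition n A f gs \<longleftrightarrow> (\<exists>bs. joint_value gs as bs \<and> (bs, c) \<in> f)"
proof
  assume "(as, c) \<in> superposition n A f gs"
  then show "\<exists>bs. joint_value gs as bs \<and> (bs, c) \<in> f"
    using assms(3)
    by (simp add: superposition_def tuples_def joint_value_def list_all2_conv_all_nth) metis
next
  assume "\<exists>bs. joint_value gs as bs \<and> (bs, c) \<in> f"
  then obtain bs where bs: "joint_value gs as bs" "(bs, c) \<in> f" by blast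
  have "bs \<in> tuples n A" "c \<in> A"
    using bs(2) assms(2) by (auto simp: partial_functions_def)
  moreover have "\<forall>i<n. (as, bs ! i) \<in> gs ! i"
    using bs(1) assms(3) by (auto simp: joint_value_def list_all2_conv_all_nth tuples_def)
  moreover have "gs ! 0 \<in> partial_functions n A"
    using assms(1,3) by (auto simp: tuples_def subset_iff)
  then have "as \<in> tuples n A"
    using \<open>\<forall>i<n. (as, bs ! i) \<in> gs ! i\<close> assms(1) by (force simp: partial_functions_def)
  ultimately show "(as, c) \<in> superposition n A f gs"
    using bs(2) by (auto simp: superposition_def)
qed

lemma joint_value_unique:
  assumes "\<And>g. g \<in> set gs \<Longrightarrow> single_valued g"
    and "joint_value gs as bs" "joint_value gs as bs'"
  shows "bs = bs'"
proof (rule nth_equalityI)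
  show "length bs = length bs'"
    using assms(2,3) by (auto simp: joint_value_def dest!: list_all2_lengthD)
  fix i assume "i < length bs"
  then have "gs ! i \<in> set gs" "(as, bs ! i) \<in> gs ! i" "(as, bs' ! i) \<in> gs ! i"
    using assms(2,3) by (auto simp: joint_value_def list_all2_conv_all_nth)
  then show "bs ! i = bs' ! i"
    using assms(1) by (blast dest: single_valuedD)
qed

lemma single_valued_if_mem_tuples:
  "gs \<in> tuples n (partial_functions n A) \<Longrightarrow> g \<in> set gs \<Longrightarrow> single_valued g"
  by (auto simp: tuples_def partial_functions_def)

lemma update_mem_tuples: "ws \<in> tuples n S \<Longrightarrow> x \<in> S \<Longrightarrow> ws[i := x] \<in> tuples n S"
  using set_update_subset_insert[of ws i x] by (auto simp: tuples_def)

lemma joint_value_update_iff: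
  assumes "i < length ws"
  shows "joint_value (ws[i := x]) as bs \<longleftrightarrow>
    length bs = length ws \<and> (as, bs ! i) \<in> x \<and>
    (\<forall>j < length ws. j \<noteq> i \<longrightarrow> (as, bs ! j) \<in> ws ! j)"
  using assms by (auto simp: joint_value_def list_all2_conv_all_nth nth_list_update)

lemma superposition_mem_partial_functions:
  assumes "n \<ge> 1" "f \<in> partial_functions n A" "gs \<in> tuples n (partial_functions n A)"
  shows "superposition n A f gs \<in> partial_functions n A"
proof -
  have "single_valued (superposition n A f gs)"
  proof (rule single_valuedI)
    fix as c c' assume "(as, c) \<in> superposition n A f gs" "(as, c') \<in> superposition n A f gs"
    then obtain bs bs' where
      "joint_value gs as bs" "(bs, c) \<in> f" "joint_value gs as bs'" "(bs', c') \<in> f"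
      using mem_superposition_iff[OF assms] by blast
    then show "c = c'"
      using joint_value_unique[of gs as bs bs'] single_valued_if_mem_tuples[OF assms(3)] assms(2)
      by (auto simp: partial_functions_def intro: single_valuedD)
  qed
  then show ?thesis by (auto simp: partial_functions_def superposition_def)
qed

text \<open>The \<open>n\<close> functions \<open>y\<^sub>i[z\<^sub>1 \<dots> z\<^sub>n]\<close> could a priori use \<open>n\<close> different intermediate
  tuples; uniqueness of the joint value of the \<open>z\<^sub>j\<close> makes them equal.\<close>

lemma joint_value_map_superposition:
  assumes "n \<ge> 1" "ys \<in> tuples n (partial_functions n A)" "zs \<in> tuples n (partial_functions n A)"
  shows "joint_value (map (\<lambda>y. superposition n A y zs) ys) as ds \<longleftrightarrow>
    (\<exists>bs. joint_value zs as bs \<and> joint_value ys bs ds)" (is "?L \<longleftrightarrow> ?R")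
proof -
  have len: "length ys = n" using assms(2) by (simp add: tuples_def)
  have mem: "(as, d) \<in> superposition n A (ys ! i) zs \<longleftrightarrow>
      (\<exists>bs. joint_value zs as bs \<and> (bs, d) \<in> ys ! i)" if "i < n" for i d
    using that assms by (intro mem_superposition_iff) (auto simp: tuples_def)
  have L: "?L \<longleftrightarrow>
      length ds = n \<and> (\<forall>i<n. \<exists>bs. joint_value zs as bs \<and> (bs, ds ! i) \<in> ys ! i)"
    using mem len by (auto simp: joint_value_def[of "map _ _"] list_all2_conv_all_nth)
  have R: "joint_value ys bs ds \<longleftrightarrow> length ds = n \<and> (\<forall>i<n. (bs, ds ! i) \<in> ys ! i)" for bs
    using len by (auto simp: joint_value_def list_all2_conv_all_nth)
  show ?thesis
  proof
    assume l: ?L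
    \<comment> \<open>Position \<open>0\<close> exists as \<open>n \<ge> 1\<close>; its intermediate tuple serves all positions.\<close>
    then obtain bs where bs: "joint_value zs as bs" using assms(1) L by force
    moreover have "bs' = bs" if "joint_value zs as bs'" for bs'
      using joint_value_unique[OF _ that bs] single_valued_if_mem_tuples[OF assms(3)] by blast
    ultimately show ?R using l L R by metis
  qed (use L R in blast)
qed

lemma superposition_superassociative:
  assumes "n \<ge> 1" "x \<in> partial_functions n A"
    and "ys \<in> tuples n (partial_functions n A)" "zs \<in> tuples n (partial_functions n A)"
  shows "superposition n A (superposition n A x ys) zs
    = superposition n A x (map (\<lambda>y. superposition n A y zs) ys)" (is "?L = ?R")
proof -
  have "map (\<lambda>y. superposition n A y zs) ys \<in> tuples n (partial_functions n A)"
    using assms superposition_mem_partial_functions by (fastforce simp: tuples_def)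
  then have "(as, c) \<in> ?L \<longleftrightarrow> (as, c) \<in> ?R" for as c
    unfolding mem_superposition_iff[OF assms(1) superposition_mem_partial_functions[OF assms(1-3)]
        assms(4)] mem_superposition_iff[OF assms(1-3)]
    by (auto simp: mem_superposition_iff[OF assms(1,2)]
        joint_value_map_superposition[OF assms(1,3,4)])
  then show ?thesis by auto
qed

lemma superposition_diff:
  assumes "n \<ge> 1" "x \<in> partial_functions n A" "y \<in> partial_functions n A"
    and "x - y \<in> partial_functions n A" "zs \<in> tuples n (partial_functions n A)"
  shows "superposition n A (x - y) zs = superposition n A x zs - superposition n A y zs"
proof -
  have unique: "bs = bs'" if "joint_value zs as bs" "joint_value zs as bs'" for as bs bs'
    using joint_value_unique[OF _ that] single_valued_if_mem_tuples[OF assms(5)] by blast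
  have "(as, c) \<in> superposition n A (x - y) zs \<longleftrightarrow>
      (as, c) \<in> superposition n A x zs - superposition n A y zs" for as c
    unfolding Diff_iff mem_superposition_iff[OF assms(1,2,5)]
      mem_superposition_iff[OF assms(1,3,5)] mem_superposition_iff[OF assms(1,4,5)]
    by (metis unique)
  then show ?thesis by auto
qed

text \<open>The joint value at \<open>ws[i := x]\<close> is unique, so it is a joint value of exactly one
  of \<open>ws[i := x \<inter> y]\<close> and \<open>ws[i := x - y]\<close>, depending on whether the entry at \<open>i\<close> is a value
  of \<open>y\<close>.\<close>

lemma superposition_update_diff_diff:
  assumes "n \<ge> 1" "u \<in> partial_functions n A" "x \<in> partial_functions n A"
    and "ws \<in> tuples n (partial_functions n A)" "i < n"
  shows "superposition n A u (ws[i := x - (x - y)])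
    = superposition n A u (ws[i := x]) - superposition n A u (ws[i := x - y])"
proof -
  have sub: "x' \<in> partial_functions n A" if "x' \<subseteq> x" for x'
    using assms(3) that single_valued_subset[OF that] by (auto simp: partial_functions_def)
  have mem: "(as, c) \<in> superposition n A u (ws[i := x']) \<longleftrightarrow>
      (\<exists>bs. joint_value (ws[i := x']) as bs \<and> (bs, c) \<in> u)" if "x' \<subseteq> x" for x' as c
    using assms sub[OF that] by (simp add: mem_superposition_iff update_mem_tuples)
  have i: "i < length ws" using assms(4,5) by (simp add: tuples_def)
  have cap: "joint_value (ws[i := x - (x - y)]) as bs \<longleftrightarrow>
      joint_value (ws[i := x]) as bs \<and> (as, bs ! i) \<in> y" for as bs
    by (auto simp: joint_value_update_iff[OF i])
  have diff: "joint_value (ws[i := x - y]) as bs \<longleftrightarrow>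
      joint_value (ws[i := x]) as bs \<and> (as, bs ! i) \<notin> y" for as bs
    by (auto simp: joint_value_update_iff[OF i])
  have unique: "bs = bs'"
    if "joint_value (ws[i := x]) as bs" "joint_value (ws[i := x]) as bs'" for as bs bs'
    using joint_value_unique[OF _ that]
      single_valued_if_mem_tuples[OF update_mem_tuples[OF assms(4,3)]] by blast
  have "(as, c) \<in> superposition n A u (ws[i := x - (x - y)]) \<longleftrightarrow>
      (as, c) \<in> superposition n A u (ws[i := x]) - superposition n A u (ws[i := x - y])" for as c
    unfolding Diff_iff mem[OF subset_refl] mem[OF Diff_subset] cap diff by (metis unique)
  then show ?thesis by auto
qed

text \<open>A tuple has a joint value only where all of its entries are defined; in a polynomial, the
  variable lies at the end of a chain of such entries.\<close>

lemma word_value_superposition_defined: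
  assumes "t \<in> polynomials n G" "(as, c) \<in> word_value (superposition n A) t x"
  shows "\<exists>d. (as, d) \<in> x"
  using assms
proof (induction arbitrary: c rule: polynomials.induct)
  case var
  then show ?case by auto
next
  case (app a bs cs t)
  let ?gs = "bs @ [word_value (superposition n A) t x] @ cs"
  obtain ds where "\<forall>i<n. (as, ds ! i) \<in> ?gs ! i"
    using app.prems
    by (simp add: superposition_def[of n A a]) blast
  moreover have "length bs < n" using app.hyps by simp
  ultimately have "(as, ds ! length bs) \<in> ?gs ! length bs" by blast
  then show ?case using app.IH by simp
qed

lemma word_value_superposition_local:
  assumes "t \<in> polynomials n G" "\<And>d. (as, d) \<in> x \<longleftrightarrow> (as, d) \<in> y"
  shows "(as, c) \<in> word_value (superposition n A) t x \<longleftrightarrow>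
    (as, c) \<in> word_value (superposition n A) t y"
  using assms(1)
proof (induction arbitrary: c rule: polynomials.induct)
  case var
  then show ?case using assms(2) by simp
next
  case (app a bs cs t)
  have "(as, d) \<in> (bs @ [word_value (superposition n A) t x] @ cs) ! i \<longleftrightarrow>
      (as, d) \<in> (bs @ [word_value (superposition n A) t y] @ cs) ! i" for i d
    using app.IH by (auto simp: nth_append nth_Cons split: nat.split)
  then show ?case by (simp add: superposition_def[of n A a])
qed

lemma word_value_superposition_subset:
  assumes "t1 \<in> polynomials n G" "t2 \<in> polynomials n G" "single_valued y" "x \<subseteq> y"
    and "z \<subseteq> word_value (superposition n A) t1 x" "z \<subseteq> word_value (superposition n A) t2 y"
  shows "z \<subseteq> word_value (superposition n A) t2 x"
proof (rule subrelI)
  fix as c assume z: "(as, c) \<in> z"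
  then obtain d where "(as, d) \<in> x"
    using word_value_superposition_defined[OF assms(1)] assms(5) by blast
  then have "(as, d') \<in> x \<longleftrightarrow> (as, d') \<in> y" for d'
    using assms(3,4) by (auto dest: single_valuedD)
  then show "(as, c) \<in> word_value (superposition n A) t2 x"
    using word_value_superposition_local[OF assms(2)] z assms(6) by blast
qed

theorem theorem1:
  fixes n :: nat and A :: "'a set" and \<Phi> :: "'a pfun set"
  assumes "n \<ge> 1"
    and "difference_menger_algebra n A \<Phi>"
  shows "subtraction_menger_algebra n \<Phi> (superposition n A) (\<lambda>f g. f - g) {}"
proof -
  interpret difference_menger_algebra n A \<Phi> by (fact assms(2))
  have pf: "f \<in> partial_functions n A" if "f \<in> \<Phi>" for f
    using partial_functions that by blast
  have tup: "gs \<in> tuples n (partial_functions n A)" if "gs \<in> tuples n \<Phi>" for gs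
    using that pf by (auto simp: tuples_def)
  show ?thesis
  proof
    show "\<Phi> \<noteq> {}" using empty_mem by blast
  next
    fix f gs assume "f \<in> \<Phi>" "gs \<in> tuples n \<Phi>"
    then show "superposition n A f gs \<in> \<Phi>" by (rule superposition_closed)
  next
    fix x ys zs assume "x \<in> \<Phi>" "ys \<in> tuples n \<Phi>" "zs \<in> tuples n \<Phi>"
    then show "superposition n A (superposition n A x ys) zs
        = superposition n A x (map (\<lambda>y. superposition n A y zs) ys)"
      using assms(1) pf tup by (intro superposition_superassociative)
  next
    fix x y zs assume "x \<in> \<Phi>" "y \<in> \<Phi>" "zs \<in> tuples n \<Phi>"
    then show "superposition n A (x - y) zs = superposition n A x zs - superposition n A y zs"
      using assms(1) pf tup difference_closed[of x y] by (intro superposition_diff) auto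
  next
    fix u x y ws i assume "u \<in> \<Phi>" "x \<in> \<Phi>" "y \<in> \<Phi>" "ws \<in> tuples n \<Phi>" "i < n"
    then show "superposition n A u (ws[i := x - (x - y)])
        = superposition n A u (ws[i := x]) - superposition n A u (ws[i := x - y])"
      using assms(1) pf tup by (intro superposition_update_diff_diff)
  next
    fix x y z t1 t2
    assume "y \<in> \<Phi>" "t1 \<in> polynomials n \<Phi>" "t2 \<in> polynomials n \<Phi>" "x - y = {}"
      "z - word_value (superposition n A) t1 x = {}" "z - word_value (superposition n A) t2 y = {}"
    moreover have "single_valued y" using pf[OF \<open>y \<in> \<Phi>\<close>] by (simp add: partial_functions_def)
    ultimately show "z - word_value (superposition n A) t2 x = {}"
      using word_value_superposition_subset[of t1 n \<Phi> t2 y x z A] by auto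
  qed (use empty_mem difference_closed in auto)
qed

end
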